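(* Let $\mathcal{E}$ be a separable complex Hilbert space, let $T \in B(l^2_{\mathcal{E}}(\mathbb{N}))$, let $n \geq 0$ be an integer, and let $$R_{T,n} = \begin{pmatrix} (S^* )^n & T \\ 0 & S^n \end{pmatrix}$$ acting on $l^2_{\mathcal{E}}(\mathbb{N}) \oplus l^2_{\mathcal{E}}(\mathbb{N})$, where $S$ is the unilateral shift on $l^2_{\mathcal{E}}(\mathbb{N})$. Then for every $\lambda > 0$, $$\lambda \in \sigma(|R_{T,n}|) \setminus \{0,1\} \quad \Longleftrightarrow \quad |\lambda - \lambda^{-1}| \in \sigma(|T|) \setminus \{0\}.$$
   Context: $l^2_{\mathcal{E}}(\mathbb{N})$ is the Hilbert space of square-summable sequences $(a_0,a_1,a_2,\ldots)$ with entries in $\mathcal{E}$, and $B(\mathcal{H})$ denotes the bounded linear operators on a Hilbert space $\mathcal{H}$. The unilateral shift $S$ on $l^2_{\mathcal{E}}(\mathbb{N})$ is $S(a_0,a_1,a_2,\ldots) = (0,a_0,a_1,\ldots)$. The modulus of a bounded operator $A$ is $|A| = \sqrt{A^*A}$, and $\sigma(A)$ denotes the spectrum of $A$. The operator $R_{T,n}$ is called a Foguel operator of order $n$. *)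

theory Defs
  imports "HOL-Analysis.Analysis"
begin

text \<open>
  The underlying real inner product, which carries norm and topology, is the real part of the
  complex one. Definiteness of \<open>cinner\<close> is therefore inherited from \<^class>\<open>real_inner\<close>.
  The complex inner product is linear in its first argument.
\<close>

class complex_inner = real_inner +
  fixes scaleC :: "complex \<Rightarrow> 'a \<Rightarrow> 'a" (infixr \<open>*\<^sub>C\<close> 75)
    and cinner :: "'a \<Rightarrow> 'a \<Rightarrow> complex"
  assumes scaleC_add_right: "c *\<^sub>C (x + y) = c *\<^sub>C x + c *\<^sub>C y"
    and scaleC_add_left: "(c + d) *\<^sub>C x = c *\<^sub>C x + d *\<^sub>C x"
    and scaleC_scaleC: "c *\<^sub>C d *\<^sub>C x = (c * d) *\<^sub>C x"
    and scaleR_scaleC: "scaleR r x = of_real r *\<^sub>C x"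
    and cinner_commute: "cinner x y = cnj (cinner y x)"
    and cinner_add_left: "cinner (x + y) z = cinner x z + cinner y z"
    and cinner_scaleC_left: "cinner (c *\<^sub>C x) y = c * cinner x y"
    and inner_eq_Re_cinner: "inner x y = Re (cinner x y)"

class complex_hilbert = complex_inner + complete_space

lemma cinner_eq_inner:
  fixes x y :: "'a::complex_inner"
  shows "cinner x y = Complex (inner x y) (- inner (\<i> *\<^sub>C x) y)"
  by (simp add: complex_eq_iff inner_eq_Re_cinner cinner_scaleC_left)

lemma norm_scaleC: "norm (c *\<^sub>C x) = cmod c * norm (x :: 'a::complex_inner)"
proof -
  have im: "Im (cinner x x) = 0"
    using arg_cong[OF cinner_commute[of x x], of Im] by simp
  have "cinner (c *\<^sub>C x) (c *\<^sub>C x) = c * cnj c * cinner x x"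
    by (metis cinner_commute cinner_scaleC_left complex_cnj_mult mult.assoc)
  then have "inner (c *\<^sub>C x) (c *\<^sub>C x) = (cmod c)\<^sup>2 * inner x x"
    using im by (simp add: inner_eq_Re_cinner complex_mult_cnj cmod_power2)
  then show ?thesis
    by (simp add: norm_eq_sqrt_inner real_sqrt_mult)
qed

instantiation prod :: (complex_inner, complex_inner) complex_inner
begin

definition scaleC_prod_def: "scaleC c p = (c *\<^sub>C fst p, c *\<^sub>C snd p)"
definition cinner_prod_def: "cinner p q = cinner (fst p) (fst q) + cinner (snd p) (snd q)"

instance
proof
  fix c d :: complex and r :: real and x y z :: "'a \<times> 'b"
  show "c *\<^sub>C (x + y) = c *\<^sub>C x + c *\<^sub>C y"
    by (simp add: scaleC_prod_def scaleC_add_right)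
  show "(c + d) *\<^sub>C x = c *\<^sub>C x + d *\<^sub>C x"
    by (simp add: scaleC_prod_def scaleC_add_left)
  show "c *\<^sub>C d *\<^sub>C x = (c * d) *\<^sub>C x"
    by (simp add: scaleC_prod_def scaleC_scaleC)
  show "scaleR r x = of_real r *\<^sub>C x"
    by (simp add: scaleC_prod_def scaleR_scaleC scaleR_prod_def)
  show "cinner x y = cnj (cinner y x)"
    by (simp add: cinner_prod_def flip: cinner_commute)
  show "cinner (x + y) z = cinner x z + cinner y z"
    by (simp add: cinner_prod_def cinner_add_left)
  show "cinner (c *\<^sub>C x) y = c * cinner x y"
    by (simp add: cinner_prod_def scaleC_prod_def cinner_scaleC_left distrib_left)
  show "inner x y = Re (cinner x y)"
    by (simp add: cinner_prod_def inner_prod_def inner_eq_Re_cinner)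
qed

end

instance prod :: (complex_hilbert, complex_hilbert) complex_hilbert ..

definition bounded_clinear :: "('a::complex_inner \<Rightarrow> 'b::complex_inner) \<Rightarrow> bool" where
  "bounded_clinear A \<longleftrightarrow> bounded_linear A \<and> (\<forall>c x. A (c *\<^sub>C x) = c *\<^sub>C A x)"

definition cadjoint :: "('a::complex_inner \<Rightarrow> 'b::complex_inner) \<Rightarrow> 'b \<Rightarrow> 'a" where
  "cadjoint A = (THE B. \<forall>x y. cinner (A x) y = cinner x (B y))"

definition positive_op :: "('a::complex_inner \<Rightarrow> 'a) \<Rightarrow> bool" where
  "positive_op A \<longleftrightarrow> bounded_clinear A \<and> (\<forall>x. cinner (A x) x \<in> \<real>\<^sub>\<ge>\<^sub>0)"

definition sqrt_op :: "('a::complex_inner \<Rightarrow> 'a) \<Rightarrow> 'a \<Rightarrow> 'a" where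
  "sqrt_op A = (THE B. positive_op B \<and> B \<circ> B = A)"

definition modulus_op :: "('a::complex_inner \<Rightarrow> 'a) \<Rightarrow> 'a \<Rightarrow> 'a" where
  "modulus_op A = sqrt_op (cadjoint A \<circ> A)"

definition spectrum_op :: "('a::complex_inner \<Rightarrow> 'a) \<Rightarrow> complex set" where
  "spectrum_op A = {z. \<not> (\<exists>B. bounded_clinear B \<and>
     B \<circ> (\<lambda>x. A x - z *\<^sub>C x) = id \<and> (\<lambda>x. A x - z *\<^sub>C x) \<circ> B = id)}"

typedef (overloaded) 'a l2seq =
  "{a :: nat \<Rightarrow> 'a::real_inner. summable (\<lambda>i. (norm (a i))\<^sup>2)}"
  morphisms l2_nth Abs_l2seq
  by (rule exI[of _ "\<lambda>_. 0"]) simp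

setup_lifting type_definition_l2seq

lemma l2_summable: "summable (\<lambda>i. (norm (l2_nth a i))\<^sup>2)"
  using l2_nth[of a] by simp

lemma l2_eqI: "(\<And>i. l2_nth a i = l2_nth b i) \<Longrightarrow> a = b"
  by (metis ext l2_nth_inject)

lemma norm_add_square_le:
  fixes x y :: "'a::real_inner"
  shows "(norm (x + y))\<^sup>2 \<le> 2 * (norm x)\<^sup>2 + 2 * (norm y)\<^sup>2"
proof -
  have "(norm (x + y))\<^sup>2 + (norm (x - y))\<^sup>2 = 2 * (norm x)\<^sup>2 + 2 * (norm y)\<^sup>2"
    by (simp add: power2_norm_eq_inner inner_add_left inner_add_right inner_diff_left
        inner_diff_right inner_commute)
  then show ?thesis
    by (smt (verit) zero_le_power2)
qed

lemma square_summable_add: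
  fixes a b :: "nat \<Rightarrow> 'a::real_inner"
  assumes "summable (\<lambda>i. (norm (a i))\<^sup>2)" and "summable (\<lambda>i. (norm (b i))\<^sup>2)"
  shows "summable (\<lambda>i. (norm (a i + b i))\<^sup>2)"
proof (rule summable_comparison_test')
  show "summable (\<lambda>i. 2 * (norm (a i))\<^sup>2 + 2 * (norm (b i))\<^sup>2)"
    using assms by (intro summable_add summable_mult)
  show "norm ((norm (a i + b i))\<^sup>2) \<le> 2 * (norm (a i))\<^sup>2 + 2 * (norm (b i))\<^sup>2" for i
    using norm_add_square_le by simp
qed

lemma square_summable_inner:
  fixes a b :: "nat \<Rightarrow> 'a::real_inner"
  assumes "summable (\<lambda>i. (norm (a i))\<^sup>2)" and "summable (\<lambda>i. (norm (b i))\<^sup>2)"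
  shows "summable (\<lambda>i. inner (a i) (b i))"
proof (rule summable_comparison_test')
  show "summable (\<lambda>i. (norm (a i))\<^sup>2 + (norm (b i))\<^sup>2)"
    using assms by (intro summable_add)
  show "norm (inner (a i) (b i)) \<le> (norm (a i))\<^sup>2 + (norm (b i))\<^sup>2" for i
  proof -
    have "\<bar>inner (a i) (b i)\<bar> \<le> norm (a i) * norm (b i)"
      by (rule Cauchy_Schwarz_ineq2)
    also have "\<dots> \<le> 2 * (norm (a i) * norm (b i))"
      by simp
    also have "\<dots> \<le> (norm (a i))\<^sup>2 + (norm (b i))\<^sup>2"
      using sum_squares_bound[of "norm (a i)" "norm (b i)"] by simp
    finally show ?thesis by simp
  qed
qed

instantiation l2seq :: (real_inner) real_inner
begin

lift_definition zero_l2seq :: "'a l2seq" is "\<lambda>_. 0"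
  by simp

lift_definition plus_l2seq :: "'a l2seq \<Rightarrow> 'a l2seq \<Rightarrow> 'a l2seq" is "\<lambda>a b i. a i + b i"
  by (rule square_summable_add)

lift_definition uminus_l2seq :: "'a l2seq \<Rightarrow> 'a l2seq" is "\<lambda>a i. - a i"
  by simp

lift_definition minus_l2seq :: "'a l2seq \<Rightarrow> 'a l2seq \<Rightarrow> 'a l2seq" is "\<lambda>a b i. a i - b i"
  subgoal for a b
    using square_summable_add[of a "\<lambda>i. - b i"] by simp
  done

lift_definition scaleR_l2seq :: "real \<Rightarrow> 'a l2seq \<Rightarrow> 'a l2seq" is "\<lambda>r a i. r *\<^sub>R a i"
  by (simp add: power_mult_distrib summable_mult)

definition inner_l2seq :: "'a l2seq \<Rightarrow> 'a l2seq \<Rightarrow> real" where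
  "inner_l2seq a b = (\<Sum>i. inner (l2_nth a i) (l2_nth b i))"

definition norm_l2seq :: "'a l2seq \<Rightarrow> real" where
  "norm_l2seq a = sqrt (inner a a)"

definition sgn_l2seq :: "'a l2seq \<Rightarrow> 'a l2seq" where
  "sgn_l2seq a = scaleR (inverse (norm a)) a"

definition dist_l2seq :: "'a l2seq \<Rightarrow> 'a l2seq \<Rightarrow> real" where
  "dist_l2seq a b = norm (a - b)"

definition uniformity_l2seq :: "('a l2seq \<times> 'a l2seq) filter" where
  "uniformity_l2seq = (INF e\<in>{0 <..}. principal {(x, y). dist x y < e})"

definition open_l2seq :: "'a l2seq set \<Rightarrow> bool" where
  "open_l2seq U \<longleftrightarrow> (\<forall>x\<in>U. eventually (\<lambda>(x', y). x' = x \<longrightarrow> y \<in> U) uniformity)"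

instance
proof
  fix a b c :: "'a l2seq" and r s :: real
  show "a + b + c = a + (b + c)" by transfer (simp add: add.assoc)
  show "a + b = b + a" by transfer (simp add: add.commute)
  show "0 + a = a" by transfer simp
  show "- a + a = 0" by transfer simp
  show "a - b = a + - b" by transfer simp
  show "r *\<^sub>R (a + b) = r *\<^sub>R a + r *\<^sub>R b" by transfer (simp add: scaleR_add_right)
  show "(r + s) *\<^sub>R a = r *\<^sub>R a + s *\<^sub>R a" by transfer (simp add: scaleR_add_left)
  show "r *\<^sub>R s *\<^sub>R a = (r * s) *\<^sub>R a" by transfer simp
  show "1 *\<^sub>R a = a" by transfer simp
  show "sgn a = inverse (norm a) *\<^sub>R a" by (rule sgn_l2seq_def)
  show "dist a b = norm (a - b)" by (rule dist_l2seq_def)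
  show "(uniformity :: ('a l2seq \<times> 'a l2seq) filter)
      = (INF e\<in>{0 <..}. principal {(x, y). dist x y < e})"
    by (rule uniformity_l2seq_def)
  show "open U \<longleftrightarrow> (\<forall>x\<in>U. eventually (\<lambda>(x', y). x' = x \<longrightarrow> y \<in> U) uniformity)"
    for U :: "'a l2seq set"
    by (rule open_l2seq_def)
  show "inner a b = inner b a"
    by (simp add: inner_l2seq_def inner_commute)
  show "inner (a + b) c = inner a c + inner b c"
    by (simp add: inner_l2seq_def plus_l2seq.rep_eq inner_add_left
        suminf_add square_summable_inner l2_summable)
  show "inner (r *\<^sub>R a) b = r * inner a b"
    by (simp add: inner_l2seq_def scaleR_l2seq.rep_eq
        suminf_mult square_summable_inner l2_summable)
  show "0 \<le> inner a a"
    by (simp add: inner_l2seq_def suminf_nonneg square_summable_inner l2_summable)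
  show "inner a a = 0 \<longleftrightarrow> a = 0"
  proof
    assume "inner a a = 0"
    then have "\<forall>i. inner (l2_nth a i) (l2_nth a i) = 0"
      using suminf_eq_zero_iff[of "\<lambda>i. inner (l2_nth a i) (l2_nth a i)"]
      by (simp add: inner_l2seq_def square_summable_inner l2_summable)
    then show "a = 0"
      by (intro l2_eqI) (simp add: zero_l2seq.rep_eq)
  next
    assume "a = 0"
    then show "inner a a = 0"
      by (simp add: inner_l2seq_def zero_l2seq.rep_eq)
  qed
  show "norm a = sqrt (inner a a)" by (rule norm_l2seq_def)
qed

end

lemma norm_l2_square: "(norm a)\<^sup>2 = (\<Sum>i. (norm (l2_nth a i))\<^sup>2)"
  by (simp add: power2_norm_eq_inner inner_l2seq_def)

lemma sum_norm_l2_le: "(\<Sum>i<n. (norm (l2_nth a i))\<^sup>2) \<le> (norm a)\<^sup>2"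
  unfolding norm_l2_square by (rule sum_le_suminf) (auto simp: l2_summable)

lemma norm_l2_nth_le: "norm (l2_nth a i) \<le> norm a"
proof -
  have "(norm (l2_nth a i))\<^sup>2 \<le> (\<Sum>j<Suc i. (norm (l2_nth a j))\<^sup>2)"
    by (simp add: sum_nonneg)
  also have "\<dots> \<le> (norm a)\<^sup>2"
    by (rule sum_norm_l2_le)
  finally show ?thesis
    by (rule power2_le_imp_le) simp
qed

instance l2seq :: ("{real_inner, complete_space}") complete_space
proof
  fix X :: "nat \<Rightarrow> 'a l2seq"
  assume X: "Cauchy X"
  have "Cauchy (\<lambda>k. l2_nth (X k) i)" for i
  proof (rule metric_CauchyI)
    fix e :: real
    assume "0 < e"
    then obtain M where "\<And>m n. m \<ge> M \<Longrightarrow> n \<ge> M \<Longrightarrow> dist (X m) (X n) < e"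
      using metric_CauchyD[OF X] by blast
    moreover have "dist (l2_nth (X m) i) (l2_nth (X n) i) \<le> dist (X m) (X n)" for m n
      using norm_l2_nth_le[of "X m - X n" i] by (simp add: dist_norm minus_l2seq.rep_eq)
    ultimately show "\<exists>M. \<forall>m\<ge>M. \<forall>n\<ge>M. dist (l2_nth (X m) i) (l2_nth (X n) i) < e"
      by (meson le_less_trans)
  qed
  then have "\<forall>i. \<exists>y. (\<lambda>k. l2_nth (X k) i) \<longlonglongrightarrow> y"
    by (simp add: Cauchy_convergent convergent_def[symmetric])
  then obtain Y where Y: "\<And>i. (\<lambda>k. l2_nth (X k) i) \<longlonglongrightarrow> Y i"
    by metis
  have bound: "\<exists>M. \<forall>m\<ge>M. \<forall>n. (\<Sum>i<n. (norm (l2_nth (X m) i - Y i))\<^sup>2) \<le> e\<^sup>2"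
    if "0 < e" for e :: real
  proof -
    obtain M where M: "\<And>m n. m \<ge> M \<Longrightarrow> n \<ge> M \<Longrightarrow> dist (X m) (X n) < e"
      using metric_CauchyD[OF X \<open>0 < e\<close>] by blast
    have "(\<Sum>i<n. (norm (l2_nth (X m) i - Y i))\<^sup>2) \<le> e\<^sup>2" if "m \<ge> M" for m n
    proof (rule LIMSEQ_le_const2)
      show "(\<lambda>k. \<Sum>i<n. (norm (l2_nth (X m) i - l2_nth (X k) i))\<^sup>2)
          \<longlonglongrightarrow> (\<Sum>i<n. (norm (l2_nth (X m) i - Y i))\<^sup>2)"
        by (intro tendsto_intros Y)
      have "(\<Sum>i<n. (norm (l2_nth (X m) i - l2_nth (X k) i))\<^sup>2) \<le> e\<^sup>2" if "k \<ge> M" for k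
      proof -
        have "(\<Sum>i<n. (norm (l2_nth (X m) i - l2_nth (X k) i))\<^sup>2) \<le> (norm (X m - X k))\<^sup>2"
          using sum_norm_l2_le[of "X m - X k" n] by (simp add: minus_l2seq.rep_eq)
        also have "\<dots> \<le> e\<^sup>2"
          using M[OF \<open>m \<ge> M\<close> \<open>k \<ge> M\<close>] by (intro power_mono) (auto simp: dist_norm)
        finally show ?thesis .
      qed
      then show "\<exists>N. \<forall>k\<ge>N. (\<Sum>i<n. (norm (l2_nth (X m) i - l2_nth (X k) i))\<^sup>2) \<le> e\<^sup>2"
        by blast
    qed
    then show ?thesis by blast
  qed
  have diff: "summable (\<lambda>i. (norm (l2_nth (X m) i - Y i))\<^sup>2)"
    if "\<forall>n. (\<Sum>i<n. (norm (l2_nth (X m) i - Y i))\<^sup>2) \<le> e\<^sup>2" for m and e :: real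
    using that by (intro summableI_nonneg_bounded) auto
  obtain m where "summable (\<lambda>i. (norm (l2_nth (X m) i - Y i))\<^sup>2)"
    using bound[of 1] diff[where e = 1] by auto
  then have "summable (\<lambda>i. (norm (Y i - l2_nth (X m) i + l2_nth (X m) i))\<^sup>2)"
    by (intro square_summable_add l2_summable) (simp add: norm_minus_commute)
  then have "summable (\<lambda>i. (norm (Y i))\<^sup>2)"
    by simp
  then have nth: "l2_nth (Abs_l2seq Y) = Y"
    by (simp add: Abs_l2seq_inverse)
  have "X \<longlonglongrightarrow> Abs_l2seq Y"
  proof (rule metric_LIMSEQ_I)
    fix e :: real
    assume "0 < e"
    then obtain M where M: "\<And>m. m \<ge> M \<Longrightarrow>
        \<forall>n. (\<Sum>i<n. (norm (l2_nth (X m) i - Y i))\<^sup>2) \<le> (e/2)\<^sup>2"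
      using bound[of "e/2"] by auto
    have "dist (X m) (Abs_l2seq Y) < e" if "m \<ge> M" for m
    proof -
      have "(norm (X m - Abs_l2seq Y))\<^sup>2 \<le> (e/2)\<^sup>2"
        unfolding norm_l2_square minus_l2seq.rep_eq nth
        by (rule suminf_le_const[OF diff[OF M[OF that]]]) (use M[OF that] in blast)
      then have "norm (X m - Abs_l2seq Y) \<le> e/2"
        by (rule power2_le_imp_le) (use \<open>0 < e\<close> in simp)
      then show ?thesis
        using \<open>0 < e\<close> by (simp add: dist_norm)
    qed
    then show "\<exists>M. \<forall>m\<ge>M. dist (X m) (Abs_l2seq Y) < e"
      by blast
  qed
  then show "convergent X"
    by (rule convergentI)
qed

lemma l2_summable_cinner:
  fixes a b :: "'a::complex_inner l2seq"
  shows "summable (\<lambda>i. cinner (l2_nth a i) (l2_nth b i))"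
proof -
  have "summable (\<lambda>i. inner (\<i> *\<^sub>C l2_nth a i) (l2_nth b i))"
    by (rule square_summable_inner) (simp_all add: norm_scaleC l2_summable)
  then show ?thesis
    by (simp add: cinner_eq_inner summable_complex_iff square_summable_inner l2_summable
        summable_minus)
qed

instantiation l2seq :: (complex_inner) complex_inner
begin

lift_definition scaleC_l2seq :: "complex \<Rightarrow> 'a l2seq \<Rightarrow> 'a l2seq" is "\<lambda>c a i. c *\<^sub>C a i"
  by (simp add: norm_scaleC power_mult_distrib summable_mult)

definition cinner_l2seq :: "'a l2seq \<Rightarrow> 'a l2seq \<Rightarrow> complex" where
  "cinner_l2seq a b = (\<Sum>i. cinner (l2_nth a i) (l2_nth b i))"

instance
proof
  fix c d :: complex and r :: real and x y z :: "'a l2seq"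
  show "c *\<^sub>C (x + y) = c *\<^sub>C x + c *\<^sub>C y"
    by transfer (simp add: scaleC_add_right)
  show "(c + d) *\<^sub>C x = c *\<^sub>C x + d *\<^sub>C x"
    by transfer (simp add: scaleC_add_left)
  show "c *\<^sub>C d *\<^sub>C x = (c * d) *\<^sub>C x"
    by transfer (simp add: scaleC_scaleC)
  show "scaleR r x = of_real r *\<^sub>C x"
    by transfer (simp add: scaleR_scaleC)
  show "cinner x y = cnj (cinner y x)"
  proof -
    have "(\<lambda>i. cnj (cinner (l2_nth y i) (l2_nth x i))) sums cnj (cinner y x)"
      unfolding cinner_l2seq_def sums_cnj by (rule summable_sums[OF l2_summable_cinner])
    then show ?thesis
      by (simp add: cinner_l2seq_def sums_iff flip: cinner_commute)
  qed
  show "cinner (x + y) z = cinner x z + cinner y z"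
    by (simp add: cinner_l2seq_def plus_l2seq.rep_eq cinner_add_left
        suminf_add l2_summable_cinner)
  show "cinner (c *\<^sub>C x) y = c * cinner x y"
    by (simp add: cinner_l2seq_def scaleC_l2seq.rep_eq cinner_scaleC_left
        suminf_mult l2_summable_cinner)
  show "inner x y = Re (cinner x y)"
    by (simp add: cinner_l2seq_def inner_l2seq_def inner_eq_Re_cinner
        Re_suminf l2_summable_cinner)
qed

end

instance l2seq :: (complex_hilbert) complex_hilbert ..

lift_definition shift :: "'a::real_inner l2seq \<Rightarrow> 'a l2seq" is "\<lambda>a. case_nat 0 a"
  subgoal for a
    by (subst summable_Suc_iff[symmetric]) simp
  done

definition foguel ::
  "('a::complex_inner l2seq \<Rightarrow> 'a l2seq) \<Rightarrow> nat \<Rightarrow> 'a l2seq \<times> 'a l2seq \<Rightarrow> 'a l2seq \<times> 'a l2seq"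
where
  "foguel T n = (\<lambda>(x, y). ((cadjoint shift ^^ n) x + T y, (shift ^^ n) y))"

end

theory Submission
  imports Defs
begin

text \<open>
  For \<open>r > 0\<close> the operator \<open>|A| + r\<close> is invertible, so \<open>r \<in> \<sigma>(|A|)\<close> iff \<open>r\<^sup>2 \<in> \<sigma>(A\<^sup>* A)\<close>.
  For a Foguel operator \<open>R\<close> and \<open>m \<noteq> 0, 1\<close>, the Schur complement of \<open>R\<^sup>* R - m\<close> with respect to
  its upper left corner is a nonzero multiple of \<open>T\<^sup>* T - (1 - m)\<^sup>2 / m\<close>, and for \<open>m = \<mu>\<^sup>2\<close> one has
  \<open>(1 - m)\<^sup>2 / m = (\<mu> - \<mu>\<^sup>-\<^sup>1)\<^sup>2\<close>.
  As \<^const>\<open>cadjoint\<close> and \<^const>\<open>sqrt_op\<close> are definite descriptions, this requires existence and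
  uniqueness of adjoints and of positive square roots.
\<close>

subsection \<open>Complex inner products\<close>

lemma scaleC_one [simp]: "1 *\<^sub>C x = (x :: 'a::complex_inner)"
  using scaleR_scaleC[of 1 x] by simp

lemma cinner_add_right: "cinner x (y + z) = cinner x y + cinner (x :: 'a::complex_inner) z"
  by (metis cinner_commute cinner_add_left complex_cnj_add)

lemma cinner_scaleC_right: "cinner x (c *\<^sub>C y) = cnj c * cinner (x :: 'a::complex_inner) y"
  by (metis cinner_commute cinner_scaleC_left complex_cnj_mult)

lemma scaleC_zero_left [simp]: "0 *\<^sub>C x = (0 :: 'a::complex_inner)"
  using scaleR_scaleC[of 0 x] by simp

lemma scaleC_zero_right [simp]: "c *\<^sub>C 0 = (0 :: 'a::complex_inner)"
  using norm_scaleC[of c "0 :: 'a"] by simp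

lemma scaleC_minus_right: "c *\<^sub>C (- x) = - (c *\<^sub>C (x :: 'a::complex_inner))"
  by (rule minus_unique[symmetric]) (simp flip: scaleC_add_right)

lemma scaleC_diff_right: "c *\<^sub>C (x - y) = c *\<^sub>C x - c *\<^sub>C (y :: 'a::complex_inner)"
  using scaleC_add_right[of c x "- y"] by (simp add: scaleC_minus_right)

lemma scaleC_diff_left: "(c - d) *\<^sub>C x = c *\<^sub>C x - d *\<^sub>C (x :: 'a::complex_inner)"
  using scaleC_add_left[of "c - d" d x] by simp

lemma cinner_ext_right:
  fixes y z :: "'a::complex_inner"
  assumes "\<And>x. cinner x y = cinner x z"
  shows "y = z"
proof -
  have "inner (y - z) y = inner (y - z) z"
    by (simp add: inner_eq_Re_cinner assms)
  then have "inner (y - z) (y - z) = 0"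
    by (simp add: inner_diff_right)
  then show ?thesis by simp
qed

lemma inner_scaleC_i: "inner (\<i> *\<^sub>C x) (\<i> *\<^sub>C y) = inner x (y :: 'a::complex_inner)"
  by (simp add: inner_eq_Re_cinner cinner_scaleC_left cinner_scaleC_right)

lemma cinner_self: "cinner x x = of_real (inner x (x :: 'a::complex_inner))"
  using arg_cong[OF cinner_commute[of x x], of Im]
  by (simp add: complex_eq_iff inner_eq_Re_cinner)

subsection \<open>Bounded complex-linear operators\<close>

lemma bounded_clinear_linear: "bounded_clinear A \<Longrightarrow> bounded_linear A"
  by (simp add: bounded_clinear_def)

lemma bounded_clinear_scaleC: "bounded_clinear A \<Longrightarrow> A (c *\<^sub>C x) = c *\<^sub>C A x"
  by (simp add: bounded_clinear_def)

lemmas bounded_clinear_add = linear_add[OF bounded_linear.linear[OF bounded_clinear_linear]]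
  and bounded_clinear_diff = linear_diff[OF bounded_linear.linear[OF bounded_clinear_linear]]
  and bounded_clinear_zero = linear_0[OF bounded_linear.linear[OF bounded_clinear_linear]]
  and bounded_clinear_neg = linear_neg[OF bounded_linear.linear[OF bounded_clinear_linear]]

lemma bounded_linear_scaleC: "bounded_linear ((*\<^sub>C) c :: 'a \<Rightarrow> 'a::complex_inner)"
  by (rule bounded_linear_intro[of _ "cmod c"])
    (simp_all add: scaleC_add_right scaleR_scaleC scaleC_scaleC mult.commute norm_scaleC)

lemma bounded_clinear_intros:
  shows "bounded_clinear (\<lambda>x. x :: 'a::complex_inner)"
    and "bounded_clinear (\<lambda>x::'a. 0 :: 'b::complex_inner)"
    and "bounded_clinear A \<Longrightarrow> bounded_clinear B \<Longrightarrow> bounded_clinear (\<lambda>x. A x + B x)"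
    and "bounded_clinear A \<Longrightarrow> bounded_clinear B \<Longrightarrow> bounded_clinear (\<lambda>x. A x - B x)"
    and "bounded_clinear A \<Longrightarrow> bounded_clinear (\<lambda>x. c *\<^sub>C A x)"
  by (auto simp: bounded_clinear_def scaleC_add_right scaleC_diff_right scaleC_scaleC mult.commute
      intro!: bounded_linear_add bounded_linear_sub bounded_linear_ident bounded_linear_zero
        bounded_linear_compose[OF bounded_linear_scaleC])

lemma bounded_clinear_scaleR: "bounded_clinear A \<Longrightarrow> bounded_clinear (\<lambda>x. r *\<^sub>R A x)"
  unfolding scaleR_scaleC by (rule bounded_clinear_intros)

lemma bounded_clinear_compose:
  "bounded_clinear A \<Longrightarrow> bounded_clinear B \<Longrightarrow> bounded_clinear (\<lambda>x. A (B x))"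
  by (auto simp: bounded_clinear_def intro: bounded_linear_compose)

lemma bounded_clinear_funpow:
  fixes A :: "'a::complex_inner \<Rightarrow> 'a"
  shows "bounded_clinear A \<Longrightarrow> bounded_clinear (A ^^ n)"
proof (induction n)
  case 0
  show ?case using bounded_clinear_intros(1) by (simp add: id_def)
next
  case (Suc n)
  then show ?case by (simp add: bounded_clinear_compose comp_def)
qed

lemma bounded_clinear_Pair:
  "bounded_clinear A \<Longrightarrow> bounded_clinear B \<Longrightarrow> bounded_clinear (\<lambda>x. (A x, B x))"
  by (auto simp: bounded_clinear_def scaleC_prod_def intro: bounded_linear_Pair)

lemma bounded_clinear_fst: "bounded_clinear A \<Longrightarrow> bounded_clinear (\<lambda>x. fst (A x))"
  and bounded_clinear_snd: "bounded_clinear A \<Longrightarrow> bounded_clinear (\<lambda>x. snd (A x))"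
  by (auto simp: bounded_clinear_def scaleC_prod_def
      intro: bounded_linear_fst_comp bounded_linear_snd_comp)

lemmas bounded_clinear_simps = bounded_clinear_add bounded_clinear_diff bounded_clinear_scaleC

subsection \<open>Riesz representation and adjoints\<close>

text \<open>The representing vector minimises \<open>\<parallel>x\<parallel>\<^sup>2 - 2 f x\<close>; minimising sequences are
  Cauchy by the parallelogram law.\<close>

lemma riesz_representation:
  fixes f :: "'a::{real_inner, complete_space} \<Rightarrow> real"
  assumes f: "bounded_linear f"
  shows "\<exists>z. \<forall>x. f x = inner x z"
proof -
  interpret f: bounded_linear f by (rule f)
  define g where "g x = (norm x)\<^sup>2 - 2 * f x" for x
  obtain K where K: "\<And>x. norm (f x) \<le> norm x * K"
    using f.bounded by blast
  have low: "- K\<^sup>2 \<le> g x" for x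
  proof -
    have "f x \<le> norm x * K" using K[of x] by simp
    moreover have "0 \<le> (norm x - K)\<^sup>2" by simp
    ultimately show ?thesis by (simp add: g_def power2_diff)
  qed
  define m where "m = Inf (range g)"
  have bdd: "bdd_below (range g)" using low by (rule bdd_belowI2)
  have m_le: "m \<le> g x" for x
    unfolding m_def by (rule cInf_lower[OF _ bdd]) simp
  have "\<exists>x. g x < m + inverse (real (Suc k))" for k
  proof -
    have "Inf (range g) < m + inverse (real (Suc k))" by (simp add: m_def)
    then show ?thesis using cInf_lessD[of "range g"] by auto
  qed
  then obtain X where X: "\<And>k. g (X k) < m + inverse (real (Suc k))" by metis
  have parallelogram: "(norm (x - y))\<^sup>2 \<le> 2 * (g x - m) + 2 * (g y - m)" for x y
  proof -
    \<comment> \<open>The linear part of \<open>g\<close> cancels in this combination. Since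
      \<open>g\<close> is at least \<open>m\<close> at the midpoint, nearly minimal points must be
      close together.\<close>
    have "g x + g y = 2 * g ((1/2) *\<^sub>R (x + y)) + (norm (x - y))\<^sup>2 / 2"
      by (simp add: g_def power2_norm_eq_inner inner_add_left inner_add_right inner_diff_left
          inner_diff_right f.scaleR f.add inner_commute field_simps)
    with m_le[of "(1/2) *\<^sub>R (x + y)"] show ?thesis by simp
  qed
  have "Cauchy X"
  proof (rule metric_CauchyI)
    fix e :: real assume "0 < e"
    then obtain M where M: "inverse (real (Suc M)) < e\<^sup>2 / 4"
      using reals_Archimedean[of "e\<^sup>2 / 4"] by auto
    have "dist (X i) (X j) < e" if "M \<le> i" "M \<le> j" for i j
    proof -
      have near: "g (X k) - m < e\<^sup>2 / 4" if "M \<le> k" for k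
      proof -
        have "inverse (real (Suc k)) \<le> inverse (real (Suc M))"
          using that by (simp add: le_imp_inverse_le)
        then show ?thesis using X[of k] M by linarith
      qed
      have "(norm (X i - X j))\<^sup>2 < e\<^sup>2"
        using parallelogram[of "X i" "X j"] near[OF that(1)] near[OF that(2)] by simp
      then show ?thesis
        using \<open>0 < e\<close> by (simp add: dist_norm power_less_imp_less_base)
    qed
    then show "\<exists>M. \<forall>i\<ge>M. \<forall>j\<ge>M. dist (X i) (X j) < e" by blast
  qed
  then obtain z where z: "X \<longlonglongrightarrow> z"
    using Cauchy_convergent convergent_def by blast
  have "(\<lambda>k. g (X k)) \<longlonglongrightarrow> g z"
    unfolding g_def by (intro tendsto_intros z f.tendsto)
  moreover have "(\<lambda>k. m + inverse (real (Suc k))) \<longlonglongrightarrow> m + 0"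
    by (intro tendsto_intros LIMSEQ_inverse_real_of_nat)
  ultimately have "g z \<le> m + 0"
    by (rule LIMSEQ_le) (use X in \<open>auto intro: less_imp_le\<close>)
  then have min: "g z \<le> g x" for x
    using m_le[of x] by simp
  have "f x = inner x z" for x
  proof -
    define d where "d = f x - inner x z"
    \<comment> \<open>For nonzero \<open>x\<close>, the quadratic
      \<open>- 2 * t * d + t^2 * (norm x)^2\<close> is least at \<open>t = d / (norm x)^2\<close>.
      Enlarging the denominator by 1 also covers \<open>x = 0\<close> and still forces
      \<open>d = 0\<close>.\<close>
    define s where "s = 1 + (norm x)\<^sup>2"
    have s: "s > 0" by (simp add: s_def add_pos_nonneg)
    define t where "t = d / s"
    have "g (z + t *\<^sub>R x) = g z - 2 * t * d + t\<^sup>2 * (norm x)\<^sup>2"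
      unfolding g_def power2_norm_eq_inner
      by (simp add: inner_add_left inner_add_right inner_commute[of z x]
          f.scaleR f.add algebra_simps power2_eq_square d_def)
    with min[of "z + t *\<^sub>R x"] have "2 * t * d \<le> t\<^sup>2 * (norm x)\<^sup>2" by simp
    also have "\<dots> \<le> t\<^sup>2 * s" by (rule mult_left_mono) (simp_all add: s_def)
    also have "\<dots> = t * d" using s by (simp add: t_def power2_eq_square)
    finally have "d * d / s \<le> 0" by (simp add: t_def)
    then have "d * d \<le> 0" using s by (simp add: divide_le_0_iff)
    then have "d = 0" using zero_le_square[of d] by (simp add: order_antisym)
    then show ?thesis by (simp add: d_def)
  qed
  then show ?thesis by blast
qed

text \<open>A vector is determined by its inner products with all vectors, so the description has at
  most one candidate. Adjoints can thus be computed by exhibiting an operator.\<close>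

lemma cadjoint_eqI:
  assumes "\<And>x y. cinner (A x) y = cinner x (B y)"
  shows "cadjoint A = B"
  unfolding cadjoint_def
proof (rule the_equality)
  fix C assume C: "\<forall>x y. cinner (A x) y = cinner x (C y)"
  show "C = B"
    by (rule ext, rule cinner_ext_right) (metis C assms)
qed (use assms in blast)

text \<open>Riesz representation of the real functionals \<open>inner (A x) y\<close> in
  \<open>x\<close> yields a real adjoint. It is also the complex one, because \<open>cinner\<close>
  is recovered from \<open>inner\<close> through multiplication by \<open>\<i>\<close>, with which
  \<open>A\<close> commutes.\<close>

lemma
  fixes A :: "'a::complex_hilbert \<Rightarrow> 'b::complex_inner"
  assumes A: "bounded_clinear A"
  shows cinner_cadjoint: "cinner (A x) y = cinner x (cadjoint A y)"
    and bounded_clinear_cadjoint: "bounded_clinear (cadjoint A)"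
proof -
  interpret A: bounded_linear A using A by (rule bounded_clinear_linear)
  have "\<exists>z. \<forall>x. inner (A x) y = inner x z" for y
    by (intro riesz_representation bounded_linear_inner_left_comp A.bounded_linear_axioms)
  then obtain B where B: "\<And>x y. inner (A x) y = inner x (B y)" by metis
  have cB: "cinner (A x) y = cinner x (B y)" for x y
    by (simp add: cinner_eq_inner B flip: bounded_clinear_scaleC[OF A])
  then have BA: "cadjoint A = B" by (rule cadjoint_eqI)
  show "cinner (A x) y = cinner x (cadjoint A y)" by (simp add: BA cB)
  obtain K where K: "K > 0" "\<And>x. norm (A x) \<le> norm x * K"
    using A.pos_bounded by blast
  have add: "B (x + y) = B x + B y" for x y
    by (rule cinner_ext_right) (simp add: cinner_add_right flip: cB)
  have scale: "B (c *\<^sub>C x) = c *\<^sub>C B x" for c x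
    by (rule cinner_ext_right) (simp add: cinner_scaleC_right flip: cB)
  have bound: "norm (B y) \<le> norm y * K" for y
  proof (cases "B y = 0")
    case False
    have "norm (B y) * norm (B y) = inner (A (B y)) y"
      by (simp add: B norm_eq_sqrt_inner)
    also have "\<dots> \<le> norm (A (B y)) * norm y" by (rule norm_cauchy_schwarz)
    also have "\<dots> \<le> norm (B y) * K * norm y" by (rule mult_right_mono[OF K(2)]) simp
    finally show ?thesis using False by (simp add: mult.commute mult.left_commute)
  qed (use K in simp)
  have "bounded_linear B"
    by (rule bounded_linear_intro[OF add _ bound]) (simp add: scaleR_scaleC scale)
  then show "bounded_clinear (cadjoint A)"
    by (simp add: bounded_clinear_def scale BA)
qed

subsection \<open>Positive operators and square roots\<close>

text \<open>Reality of \<open>cinner (A x) x\<close> says that the real bilinear form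
  \<open>inner (\<i> *\<^sub>C A u) v\<close> is alternating, hence antisymmetric. Inserting
  \<open>\<i> *\<^sub>C x\<close> for \<open>u\<close> turns antisymmetry into symmetry of
  \<open>A\<close>.\<close>

lemma positive_op_symmetric:
  assumes "positive_op A"
  shows "inner (A x) y = inner x (A y)"
proof -
  have A: "bounded_clinear A" using assms by (simp add: positive_op_def)
  have "Im (cinner (A x) x) = 0" for x
    using assms by (simp add: positive_op_def complex_nonneg_Reals_iff)
  then have alt: "inner (\<i> *\<^sub>C A x) x = 0" for x
    by (simp add: cinner_eq_inner)
  have alt2: "inner (\<i> *\<^sub>C A u) v = - inner (\<i> *\<^sub>C A v) u" for u v
    using alt[of "u + v"] alt[of u] alt[of v]
    by (simp add: bounded_clinear_add[OF A] scaleC_add_right inner_add_left inner_add_right)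
  have "inner (A x) y = - inner (\<i> *\<^sub>C A (\<i> *\<^sub>C x)) y"
    by (simp add: bounded_clinear_scaleC[OF A] scaleC_scaleC inner_eq_Re_cinner cinner_scaleC_left)
  also have "\<dots> = inner (\<i> *\<^sub>C A y) (\<i> *\<^sub>C x)" by (simp add: alt2[of "\<i> *\<^sub>C x" y])
  finally show ?thesis by (simp add: inner_scaleC_i inner_commute)
qed

lemma positive_op_inner_nonneg: "positive_op A \<Longrightarrow> 0 \<le> inner (A x) x"
  by (simp add: positive_op_def complex_nonneg_Reals_iff inner_eq_Re_cinner)

text \<open>For complex-linear \<open>A\<close>, symmetry in the real inner product already makes
  \<open>cinner (A x) x\<close> real: its imaginary part equals its own negative, since
  multiplication by \<open>\<i>\<close> is a real isometry.\<close>

lemma positive_opI: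
  assumes A: "bounded_clinear A"
    and sym: "\<And>x y. inner (A x) y = inner x (A y)" and nonneg: "\<And>x. 0 \<le> inner (A x) x"
  shows "positive_op A"
  unfolding positive_op_def
proof (intro conjI allI A)
  fix x
  have "inner (\<i> *\<^sub>C A x) x = inner (\<i> *\<^sub>C \<i> *\<^sub>C A x) (\<i> *\<^sub>C x)" by (simp add: inner_scaleC_i)
  also have "\<dots> = - inner (A x) (\<i> *\<^sub>C x)"
    by (simp add: scaleC_scaleC inner_eq_Re_cinner cinner_scaleC_left)
  also have "\<dots> = - inner (\<i> *\<^sub>C A x) x"
    by (simp add: sym bounded_clinear_scaleC[OF A] inner_commute)
  finally have "inner (\<i> *\<^sub>C A x) x = 0" by simp
  then show "cinner (A x) x \<in> \<real>\<^sub>\<ge>\<^sub>0"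
    using nonneg[of x] by (simp add: cinner_eq_inner complex_nonneg_Reals_iff)
qed

text \<open>The quadratic form of \<open>A\<close> is nonnegative at
  \<open>x - t *\<^sub>R A x\<close>. The choice \<open>t = inverse M\<close> minimises
  \<open>t^2 * M - 2 * t\<close> and so gives the best estimate.\<close>

lemma positive_op_norm_square_le:
  assumes A: "positive_op A" and M: "0 < M" and bound: "norm (A (A x)) \<le> norm (A x) * M"
  shows "(norm (A x))\<^sup>2 \<le> M * inner (A x) x"
proof -
  interpret A: bounded_linear A
    using A by (simp add: positive_op_def bounded_clinear_def)
  define t where "t = inverse M"
  have "0 \<le> inner (A (x - t *\<^sub>R A x)) (x - t *\<^sub>R A x)"
    by (rule positive_op_inner_nonneg[OF A])
  also have "\<dots> = inner (A x) x - 2 * t * (norm (A x))\<^sup>2 + t\<^sup>2 * inner (A (A x)) (A x)"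
    unfolding power2_norm_eq_inner
    by (simp add: A.diff A.scaleR inner_diff_left inner_diff_right
        power2_eq_square positive_op_symmetric[OF A, of "A x" x] algebra_simps)
  also have "inner (A (A x)) (A x) \<le> (norm (A x) * M) * norm (A x)"
    by (rule order_trans[OF norm_cauchy_schwarz mult_right_mono[OF bound]]) simp
  then have "t\<^sup>2 * inner (A (A x)) (A x) \<le> t\<^sup>2 * (M * (norm (A x))\<^sup>2)"
    by (intro mult_left_mono) (simp_all add: power2_eq_square mult_ac)
  also have "\<dots> = t * (norm (A x))\<^sup>2" using M by (simp add: t_def power2_eq_square)
  finally have "t * (norm (A x))\<^sup>2 \<le> inner (A x) x" by simp
  then have "M * (t * (norm (A x))\<^sup>2) \<le> M * inner (A x) x"
    using M by (intro mult_left_mono) simp_all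
  moreover have "M * (t * (norm (A x))\<^sup>2) = (norm (A x))\<^sup>2" using M by (simp add: t_def)
  ultimately show ?thesis by simp
qed

lemma positive_op_kernel:
  assumes A: "positive_op A" and "inner (A x) x = 0"
  shows "A x = 0"
proof -
  obtain K where "K > 0" "\<And>x. norm (A x) \<le> norm x * K"
    using A bounded_linear.pos_bounded unfolding positive_op_def bounded_clinear_def by blast
  then show ?thesis using positive_op_norm_square_le[OF A, of K x] assms(2) by simp
qed

text \<open>The iteration \<open>B \<mapsto> (X + B\<^sup>2) / 2\<close> solves \<open>(1 - B)\<^sup>2 = 1 - X\<close>. If \<open>X\<close> is a contraction,
  it is majorised by the same iteration on reals with \<open>X = 1\<close>, which increases to a limit
  \<open>\<le> 1\<close>; hence it converges in norm.\<close>

primrec sqrt_iter :: "('a::real_vector \<Rightarrow> 'a) \<Rightarrow> nat \<Rightarrow> 'a \<Rightarrow> 'a" where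
  "sqrt_iter X 0 = (\<lambda>x. 0)"
| "sqrt_iter X (Suc n) = (\<lambda>x. (1/2) *\<^sub>R (X x + sqrt_iter X n (sqrt_iter X n x)))"

primrec sqrt_majorant :: "nat \<Rightarrow> real" where
  "sqrt_majorant 0 = 0"
| "sqrt_majorant (Suc n) = (1 + (sqrt_majorant n)\<^sup>2) / 2"

lemma sqrt_majorant_bounds: "0 \<le> sqrt_majorant n \<and> sqrt_majorant n \<le> 1"
proof (induction n)
  case (Suc n)
  then have "(sqrt_majorant n)\<^sup>2 \<le> 1" by (simp add: power_le_one)
  then show ?case by simp
qed simp

text \<open>Each increment is half the square of \<open>sqrt_majorant n - 1\<close>.\<close>

lemma incseq_sqrt_majorant: "incseq sqrt_majorant"
proof (rule incseq_SucI)
  show "sqrt_majorant n \<le> sqrt_majorant (Suc n)" for n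
    using zero_le_power2[of "sqrt_majorant n - 1"] by (simp add: power2_diff)
qed

lemma sqrt_iter_bounded_linear:
  fixes X :: "'a::real_normed_vector \<Rightarrow> 'a"
  assumes "bounded_linear X"
  shows "bounded_linear (sqrt_iter X n)"
proof (induction n)
  case (Suc n)
  show ?case
    unfolding sqrt_iter.simps
    by (intro bounded_linear_const_scaleR bounded_linear_add assms bounded_linear_compose[OF Suc Suc])
qed (simp add: bounded_linear_zero)

lemma sqrt_iter_bound:
  assumes "\<And>x. norm (X x) \<le> norm x"
  shows "norm (sqrt_iter X n x) \<le> sqrt_majorant n * norm x"
proof (induction n arbitrary: x)
  case (Suc n)
  let ?b = "sqrt_majorant n"
  have "norm (sqrt_iter X n (sqrt_iter X n x)) \<le> ?b * (?b * norm x)"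
    by (rule order_trans[OF Suc mult_left_mono[OF Suc]]) (simp add: sqrt_majorant_bounds)
  then have "norm (X x + sqrt_iter X n (sqrt_iter X n x)) \<le> norm x + ?b\<^sup>2 * norm x"
    using norm_triangle_ineq[of "X x" "sqrt_iter X n (sqrt_iter X n x)"] assms[of x]
    by (simp add: power2_eq_square mult.assoc)
  then show ?case
    unfolding sqrt_iter.simps(2) sqrt_majorant.simps(2) norm_scaleR by (simp add: field_simps)
qed simp

text \<open>With consecutive iterates \<open>B\<close> and \<open>C\<close>, the next increment is
  half of \<open>C C - B B = C (C - B) + (C - B) B\<close>, a splitting that needs no commutativity.
  The real majorant satisfies the same identity, so the bounds propagate; the second term uses the
  induction hypothesis at \<open>B x\<close>.\<close>

lemma sqrt_iter_step:
  assumes X: "bounded_linear X" "\<And>x. norm (X x) \<le> norm x"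
  shows "norm (sqrt_iter X (Suc n) x - sqrt_iter X n x)
    \<le> (sqrt_majorant (Suc n) - sqrt_majorant n) * norm x"
proof (induction n arbitrary: x)
  case 0
  show ?case using X(2)[of x] by simp
next
  case (Suc n)
  let ?B = "sqrt_iter X n" and ?C = "sqrt_iter X (Suc n)"
  let ?b = "sqrt_majorant n" and ?c = "sqrt_majorant (Suc n)"
  have d: "0 \<le> ?c - ?b"
    using incseq_SucD[OF incseq_sqrt_majorant, of n] by simp
  have "norm (?C (?C x - ?B x)) \<le> ?c * ((?c - ?b) * norm x)"
    by (rule order_trans[OF sqrt_iter_bound[OF X(2)] mult_left_mono[OF Suc]])
      (use sqrt_majorant_bounds in blast)
  moreover have "norm (?C (?B x) - ?B (?B x)) \<le> (?c - ?b) * (?b * norm x)"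
    by (rule order_trans[OF Suc mult_left_mono[OF sqrt_iter_bound[OF X(2)] d]])
  moreover have "sqrt_iter X (Suc (Suc n)) x - ?C x
      = (1/2) *\<^sub>R (?C (?C x - ?B x) + (?C (?B x) - ?B (?B x)))"
  proof -
    have 1: "?C x = (1/2) *\<^sub>R (X x + ?B (?B x))" by simp
    have 2: "sqrt_iter X (Suc (Suc n)) x = (1/2) *\<^sub>R (X x + ?C (?C x))"
      by (rule fun_cong[OF sqrt_iter.simps(2)])
    have "sqrt_iter X (Suc (Suc n)) x - ?C x
        = (1/2) *\<^sub>R (X x + ?C (?C x)) - (1/2) *\<^sub>R (X x + ?B (?B x))"
      by (simp only: 1 2)
    then show ?thesis
      unfolding linear_diff[OF bounded_linear.linear[OF sqrt_iter_bounded_linear[OF X(1)]]]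
      by (simp add: algebra_simps del: sqrt_iter.simps)
  qed
  moreover have "(sqrt_majorant (Suc (Suc n)) - ?c) * norm x
      = (?c * ((?c - ?b) * norm x) + (?c - ?b) * (?b * norm x)) / 2"
    unfolding sqrt_majorant.simps(2)[of "Suc n"]
    by (simp add: algebra_simps power2_eq_square add_divide_distrib diff_divide_distrib)
  ultimately show ?case
    by (simp del: sqrt_iter.simps sqrt_majorant.simps)
      (smt (verit) norm_triangle_ineq)
qed

text \<open>The fixpoint equation expresses that \<open>1 - B\<close> squares to
  \<open>1 - X\<close>. The iterates are polynomials in \<open>X\<close>, so symmetry and
  commutation with \<open>C\<close> pass to the limit. Commutation later yields complex linearity of
  \<open>B\<close> and uniqueness of square roots.\<close>

lemma contraction_sqrt:
  fixes X :: "'a::{real_inner, complete_space} \<Rightarrow> 'a"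
  assumes X: "bounded_linear X" "\<And>x. norm (X x) \<le> norm x"
    and sym: "\<And>x y. inner (X x) y = inner x (X y)"
  obtains B where "bounded_linear B" "\<And>x. norm (B x) \<le> norm x"
    "\<And>x. 2 *\<^sub>R B x = X x + B (B x)" "\<And>x y. inner (B x) y = inner x (B y)"
    "\<And>C. bounded_linear C \<Longrightarrow> C \<circ> X = X \<circ> C \<Longrightarrow> C \<circ> B = B \<circ> C"
proof -
  let ?B = "sqrt_iter X" and ?b = sqrt_majorant
  note lin = sqrt_iter_bounded_linear[OF X(1)]
  have tel: "norm (?B (n + k) x - ?B n x) \<le> (?b (n + k) - ?b n) * norm x" for n k x
  proof (induction k)
    case (Suc k)
    have "norm (?B (n + Suc k) x - ?B n x)
        \<le> norm (?B (Suc (n + k)) x - ?B (n + k) x) + norm (?B (n + k) x - ?B n x)"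
      using norm_triangle_ineq[of "?B (Suc (n + k)) x - ?B (n + k) x" "?B (n + k) x - ?B n x"]
      by (simp del: sqrt_iter.simps)
    also have "\<dots> \<le> (?b (Suc (n + k)) - ?b (n + k)) * norm x + (?b (n + k) - ?b n) * norm x"
      by (rule add_mono[OF sqrt_iter_step[OF X] Suc])
    also have "\<dots> = (?b (n + Suc k) - ?b n) * norm x"
      by (simp add: left_diff_distrib del: sqrt_majorant.simps)
    finally show ?case .
  qed simp
  obtain l where l: "?b \<longlonglongrightarrow> l"
    using incseq_convergent[OF incseq_sqrt_majorant] sqrt_majorant_bounds by metis
  have b_le: "?b n \<le> l" for n
    using incseq_le[OF incseq_sqrt_majorant l] .
  have "Cauchy (\<lambda>n. ?B n x)" for x
  proof (rule metric_CauchyI)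
    fix e :: real assume e: "0 < e"
    have "(\<lambda>n. (l - ?b n) * norm x) \<longlonglongrightarrow> (l - l) * norm x" by (intro tendsto_intros l)
    then have "\<forall>\<^sub>F n in sequentially. (l - ?b n) * norm x < e / 2"
      by (rule order_tendstoD) (use e in simp)
    then obtain M where M: "(l - ?b M) * norm x < e / 2" by (auto simp: eventually_sequentially)
    have "dist (?B i x) (?B M x) < e / 2" if "M \<le> i" for i
    proof -
      have "norm (?B i x - ?B M x) \<le> (?b i - ?b M) * norm x"
        using tel[of M "i - M" x] that by simp
      also have "\<dots> \<le> (l - ?b M) * norm x" by (intro mult_right_mono) (simp_all add: b_le)
      finally show ?thesis using M by (simp add: dist_norm)
    qed
    then show "\<exists>M. \<forall>i\<ge>M. \<forall>j\<ge>M. dist (?B i x) (?B j x) < e"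
      by (meson dist_triangle_half_l)
  qed
  then have "\<forall>x. \<exists>y. (\<lambda>n. ?B n x) \<longlonglongrightarrow> y"
    using Cauchy_convergent convergent_def by blast
  then obtain B where B: "\<And>x. (\<lambda>n. ?B n x) \<longlonglongrightarrow> B x" by metis
  have iter_le: "norm (?B n x) \<le> norm x" for n x
    using sqrt_iter_bound[OF X(2), of n x] sqrt_majorant_bounds[of n]
    by (meson mult_left_le_one_le norm_ge_zero order_trans)
  have B_le: "norm (B x) \<le> norm x" for x
    by (rule LIMSEQ_le_const2[OF tendsto_norm[OF B]]) (use iter_le in blast)
  have add: "B (x + y) = B x + B y" for x y
  proof (rule LIMSEQ_unique[OF B])
    show "(\<lambda>n. ?B n (x + y)) \<longlonglongrightarrow> B x + B y"
      unfolding linear_add[OF bounded_linear.linear[OF lin]] by (intro tendsto_intros B)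
  qed
  have scale: "B (r *\<^sub>R x) = r *\<^sub>R B x" for r x
  proof (rule LIMSEQ_unique[OF B])
    show "(\<lambda>n. ?B n (r *\<^sub>R x)) \<longlonglongrightarrow> r *\<^sub>R B x"
      unfolding linear_scale[OF bounded_linear.linear[OF lin]] by (intro tendsto_intros B)
  qed
  have lin_B: "bounded_linear B"
    by (rule bounded_linear_intro[OF add scale, of 1]) (simp add: B_le)
  have BB: "(\<lambda>n. ?B n (?B n x)) \<longlonglongrightarrow> B (B x)" for x
  proof -
    \<comment> \<open>Both the operator and its argument vary with \<open>n\<close>. Since all
      iterates are contractions, the error in the argument is not amplified.\<close>
    have "(\<lambda>n. ?B n (?B n x - B x)) \<longlonglongrightarrow> 0"
    proof (rule Lim_null_comparison)
      show "\<forall>\<^sub>F n in sequentially. norm (?B n (?B n x - B x)) \<le> norm (?B n x - B x)"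
        by (simp add: iter_le)
      show "(\<lambda>n. norm (?B n x - B x)) \<longlonglongrightarrow> 0"
        using tendsto_norm[OF tendsto_diff[OF B tendsto_const], of x "B x"] by simp
    qed
    from tendsto_add[OF this B[of "B x"]] show ?thesis
      by (simp add: linear_diff[OF bounded_linear.linear[OF lin]])
  qed
  have fixpoint: "2 *\<^sub>R B x = X x + B (B x)" for x
  proof -
    have "(\<lambda>n. 2 *\<^sub>R ?B (Suc n) x) \<longlonglongrightarrow> 2 *\<^sub>R B x"
      by (intro tendsto_intros LIMSEQ_Suc B)
    moreover have "(\<lambda>n. 2 *\<^sub>R ?B (Suc n) x) \<longlonglongrightarrow> X x + B (B x)"
      unfolding sqrt_iter.simps by simp (intro tendsto_intros BB)
    ultimately show ?thesis by (rule LIMSEQ_unique)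
  qed
  have sym_iter: "inner (?B n x) y = inner x (?B n y)" for n x y
    by (induction n arbitrary: x y) (simp_all add: inner_add_left inner_add_right sym)
  have sym_B: "inner (B x) y = inner x (B y)" for x y
  proof (rule LIMSEQ_unique)
    show "(\<lambda>n. inner (?B n x) y) \<longlonglongrightarrow> inner (B x) y" by (intro tendsto_intros B)
    show "(\<lambda>n. inner (?B n x) y) \<longlonglongrightarrow> inner x (B y)"
      unfolding sym_iter by (intro tendsto_intros B)
  qed
  have comm: "C \<circ> B = B \<circ> C" if C: "bounded_linear C" "C \<circ> X = X \<circ> C" for C
  proof
    fix x
    interpret C: bounded_linear C by (rule C)
    have "C (X x) = X (C x)" for x using C(2) by (metis comp_apply)
    then have CB: "C (?B n x) = ?B n (C x)" for n x
      by (induction n arbitrary: x) (simp_all add: C.zero C.scaleR C.add)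
    have "(\<lambda>n. C (?B n x)) \<longlonglongrightarrow> C (B x)" by (intro C.tendsto B)
    then show "(C \<circ> B) x = (B \<circ> C) x"
      unfolding CB using B LIMSEQ_unique by (metis comp_apply)
  qed
  show thesis by (rule that[OF lin_B B_le fixpoint sym_B comm])
qed

text \<open>With \<open>K\<close> a norm bound for \<open>A\<close>, positivity makes
  \<open>X = 1 - A / K\<close> a contraction. If \<open>(1 - B)^2 = 1 - X = A / K\<close>, then
  \<open>sqrt K\<close> times \<open>1 - B\<close> is a root of \<open>A\<close>.\<close>

lemma positive_sqrt_exists:
  fixes A :: "'a::complex_hilbert \<Rightarrow> 'a"
  assumes A: "positive_op A"
  obtains D where "positive_op D" "D \<circ> D = A"
    "\<And>C. bounded_linear C \<Longrightarrow> C \<circ> A = A \<circ> C \<Longrightarrow> C \<circ> D = D \<circ> C"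
proof -
  have cA: "bounded_clinear A" using A by (simp add: positive_op_def)
  then interpret A: bounded_linear A by (rule bounded_clinear_linear)
  obtain K where K: "K > 0" "\<And>x. norm (A x) \<le> norm x * K"
    using A.pos_bounded by blast
  define X where "X x = x - inverse K *\<^sub>R A x" for x
  have cX: "bounded_clinear X"
    unfolding X_def by (intro bounded_clinear_intros bounded_clinear_scaleR cA)
  have symX: "inner (X x) y = inner x (X y)" for x y
    by (simp add: X_def inner_diff_left inner_diff_right positive_op_symmetric[OF A])
  have X_le: "norm (X x) \<le> norm x" for x
  proof -
    have "inverse K * (norm (A x))\<^sup>2 \<le> inverse K * (K * inner (A x) x)"
      by (rule mult_left_mono[OF positive_op_norm_square_le[OF A K(1,2)]]) (use K in simp)
    also have "\<dots> = inner (A x) x" using K(1) by simp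
    finally have le: "inverse K * (norm (A x))\<^sup>2 \<le> inner (A x) x" .
    have "(norm (X x))\<^sup>2
        = (norm x)\<^sup>2 - 2 * (inverse K * inner (A x) x) + inverse K * (inverse K * (norm (A x))\<^sup>2)"
      unfolding power2_norm_eq_inner
      by (simp add: X_def inner_diff_left inner_diff_right inner_commute[of x "A x"] algebra_simps)
    also have "\<dots> \<le> (norm x)\<^sup>2 - 2 * (inverse K * inner (A x) x) + inverse K * inner (A x) x"
      by (intro add_left_mono mult_left_mono le) (use K in simp)
    also have "\<dots> \<le> (norm x)\<^sup>2"
      using K(1) positive_op_inner_nonneg[OF A, of x] by simp
    finally show ?thesis by (rule power2_le_imp_le) simp
  qed
  obtain B where B: "bounded_linear B" "\<And>x. norm (B x) \<le> norm x"
    and fixpoint: "\<And>x. 2 *\<^sub>R B x = X x + B (B x)" and symB: "\<And>x y. inner (B x) y = inner x (B y)"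
    and comm: "\<And>C. bounded_linear C \<Longrightarrow> C \<circ> X = X \<circ> C \<Longrightarrow> C \<circ> B = B \<circ> C"
    using contraction_sqrt[OF bounded_clinear_linear[OF cX] X_le symX] by blast
  interpret B: bounded_linear B by (rule B)
  \<comment> \<open>The iteration is only real-linear in form. Complex linearity of the limit is the
    commutation property applied to multiplication by a complex scalar.\<close>
  have "(*\<^sub>C) c \<circ> B = B \<circ> (*\<^sub>C) c" for c
    by (rule comm[OF bounded_linear_scaleC]) (simp add: fun_eq_iff bounded_clinear_scaleC[OF cX])
  then have cB: "bounded_clinear B"
    by (simp add: bounded_clinear_def B fun_eq_iff)
  define D where "D x = sqrt K *\<^sub>R (x - B x)" for x
  have cD: "bounded_clinear D"
    unfolding D_def by (intro bounded_clinear_intros bounded_clinear_scaleR cB)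
  have posD: "positive_op D"
  proof (rule positive_opI[OF cD])
    show "inner (D x) y = inner x (D y)" for x y
      by (simp add: D_def inner_diff_left inner_diff_right symB)
    have "inner (B x) x \<le> inner x x" for x
      using norm_cauchy_schwarz[of "B x" x] mult_right_mono[OF B(2)[of x], of "norm x"]
      by (simp add: norm_eq_sqrt_inner)
    then show "0 \<le> inner (D x) x" for x
      using K(1) by (simp add: D_def inner_diff_left)
  qed
  have "D (D x) = A x" for x
  proof -
    have "D (D x) = (sqrt K * sqrt K) *\<^sub>R (x - 2 *\<^sub>R B x + B (B x))"
      by (simp add: D_def B.diff B.scaleR scaleR_2 algebra_simps)
    also have "\<dots> = A x" using K(1) by (simp add: fixpoint X_def)
    finally show ?thesis .
  qed
  then have DD: "D \<circ> D = A" by (simp add: fun_eq_iff)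
  have "C \<circ> D = D \<circ> C" if C: "bounded_linear C" "C \<circ> A = A \<circ> C" for C
  proof -
    interpret C: bounded_linear C by (rule C)
    have "C \<circ> X = X \<circ> C"
      using C(2) by (simp add: fun_eq_iff X_def C.diff C.scaleR)
    from comm[OF C(1) this] show ?thesis
      by (simp add: fun_eq_iff D_def C.diff C.scaleR)
  qed
  then show thesis using that posD DD by blast
qed

text \<open>Another root \<open>C\<close> commutes with \<open>A = C \<circ> C\<close>, hence with
  \<open>D\<close>. So \<open>C + D\<close> kills \<open>y = C x - D x\<close>; both nonnegative
  forms vanish at \<open>y\<close>, whence \<open>C y = D y = 0\<close>, and symmetry gives
  \<open>inner y y = 0\<close>.\<close>

lemma ex1_positive_sqrt:
  fixes A :: "'a::complex_hilbert \<Rightarrow> 'a"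
  assumes A: "positive_op A"
  shows "\<exists>!B. positive_op B \<and> B \<circ> B = A"
proof -
  obtain D where D: "positive_op D" "D \<circ> D = A"
    and comm: "\<And>C. bounded_linear C \<Longrightarrow> C \<circ> A = A \<circ> C \<Longrightarrow> C \<circ> D = D \<circ> C"
    using positive_sqrt_exists[OF A] by blast
  have "C = D" if C: "positive_op C" "C \<circ> C = A" for C
  proof
    fix x
    have linC: "bounded_linear C" and linD: "bounded_linear D"
      using C D by (simp_all add: positive_op_def bounded_clinear_def)
    have "C \<circ> D = D \<circ> C" by (rule comm[OF linC]) (simp add: C(2)[symmetric] comp_assoc)
    then have CD: "C (D x) = D (C x)" by (metis comp_apply)
    have CC: "C (C x) = D (D x)" using C(2) D(2) by (metis comp_apply)
    define y where "y = C x - D x"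
    have "C y + D y = 0"
      by (simp add: y_def linear_diff[OF bounded_linear.linear[OF linC]]
          linear_diff[OF bounded_linear.linear[OF linD]] CD CC)
    then have "inner (C y) y + inner (D y) y = 0"
      by (simp flip: inner_add_left)
    then have "inner (C y) y = 0" "inner (D y) y = 0"
      using positive_op_inner_nonneg[OF C(1), of y] positive_op_inner_nonneg[OF D(1), of y]
      by simp_all
    then have "C y = 0" "D y = 0"
      using positive_op_kernel C(1) D(1) by blast+
    moreover have "inner y y = inner (C y) x - inner (D y) x"
      using positive_op_symmetric[OF C(1), of y x] positive_op_symmetric[OF D(1), of y x]
      by (simp add: inner_diff_right y_def)
    ultimately have "inner y y = 0" by simp
    then show "C x = D x" by (simp add: y_def)
  qed
  with D show ?thesis by blast
qed

text \<open>The form of \<open>cadjoint A \<circ> A\<close> at \<open>x\<close> is the squared norm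
  of \<open>A x\<close>, so the description defining the root is satisfied. These two facts are all
  that is used about the modulus from here on.\<close>

lemma
  fixes A :: "'a::complex_hilbert \<Rightarrow> 'a"
  assumes A: "bounded_clinear A"
  shows positive_op_modulus: "positive_op (modulus_op A)"
    and modulus_op_square: "modulus_op A (modulus_op A x) = cadjoint A (A x)"
proof -
  have "positive_op (cadjoint A \<circ> A)"
    unfolding positive_op_def
  proof (intro conjI allI)
    show "bounded_clinear (cadjoint A \<circ> A)"
      unfolding comp_def by (rule bounded_clinear_compose[OF bounded_clinear_cadjoint[OF A] A])
    fix x
    have "cinner ((cadjoint A \<circ> A) x) x = cnj (cinner (A x) (A x))"
      by (subst cinner_commute) (simp add: cinner_cadjoint[OF A])
    then show "cinner ((cadjoint A \<circ> A) x) x \<in> \<real>\<^sub>\<ge>\<^sub>0"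
      by (simp add: cinner_self complex_nonneg_Reals_iff)
  qed
  from theI'[OF ex1_positive_sqrt[OF this]]
  have "positive_op (modulus_op A) \<and> modulus_op A \<circ> modulus_op A = cadjoint A \<circ> A"
    by (simp add: modulus_op_def sqrt_op_def)
  then show "positive_op (modulus_op A)" "modulus_op A (modulus_op A x) = cadjoint A (A x)"
    by (simp_all add: fun_eq_iff)
qed

subsection \<open>Invertibility and spectra\<close>

definition cinvertible :: "('a::complex_inner \<Rightarrow> 'b::complex_inner) \<Rightarrow> bool" where
  "cinvertible A \<longleftrightarrow> (\<exists>B. bounded_clinear B \<and> (\<forall>x. B (A x) = x) \<and> (\<forall>x. A (B x) = x))"

lemma spectrum_op_iff: "z \<in> spectrum_op A \<longleftrightarrow> \<not> cinvertible (\<lambda>x. A x - z *\<^sub>C x)"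
  by (simp add: spectrum_op_def cinvertible_def fun_eq_iff)

lemma cinvertible_compose_iff:
  assumes "bounded_clinear A" "cinvertible A"
  shows "cinvertible (\<lambda>x. B (A x)) \<longleftrightarrow> cinvertible B"
proof -
  obtain A' where A': "bounded_clinear A'" "\<And>x. A' (A x) = x" "\<And>x. A (A' x) = x"
    using assms(2) by (auto simp: cinvertible_def)
  show ?thesis
  proof
    assume "cinvertible B"
    then obtain B' where "bounded_clinear B'" "\<And>x. B' (B x) = x" "\<And>x. B (B' x) = x"
      by (auto simp: cinvertible_def)
    with A' show "cinvertible (\<lambda>x. B (A x))"
      unfolding cinvertible_def
      by (intro exI[of _ "\<lambda>x. A' (B' x)"]) (simp add: bounded_clinear_compose)
  next
    assume "cinvertible (\<lambda>x. B (A x))"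
    then obtain C where C: "bounded_clinear C" "\<And>x. C (B (A x)) = x" "\<And>x. B (A (C x)) = x"
      by (auto simp: cinvertible_def)
    \<comment> \<open>The left inverse identity at \<open>A' x\<close> reads
      \<open>C (B x) = A' x\<close>; now apply \<open>A\<close>.\<close>
    have "A (C (B x)) = x" for x using C(2)[of "A' x"] by (simp add: A')
    with C assms(1) show "cinvertible B"
      unfolding cinvertible_def
      by (intro exI[of _ "\<lambda>x. A (C x)"]) (simp add: bounded_clinear_compose)
  qed
qed

lemma cinvertible_scaleC_iff:
  assumes "c \<noteq> 0" "bounded_clinear A"
  shows "cinvertible (\<lambda>x. c *\<^sub>C A x) \<longleftrightarrow> cinvertible A"
proof -
  have lin: "bounded_clinear (\<lambda>x. c *\<^sub>C x)" by (intro bounded_clinear_intros)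
  have "cinvertible (\<lambda>x. c *\<^sub>C x)"
    unfolding cinvertible_def using assms
    by (intro exI[of _ "\<lambda>x. inverse c *\<^sub>C x"]) (simp add: bounded_clinear_intros scaleC_scaleC)
  from cinvertible_compose_iff[OF lin this, of A] show ?thesis
    by (simp add: bounded_clinear_scaleC[OF assms(2)])
qed

text \<open>A Lax-Milgram argument: coercivity bounds \<open>A\<close> from below, which gives
  injectivity and a bounded inverse, while surjectivity comes from the Banach fixed point theorem
  for \<open>x - r *\<^sub>R (A x - y)\<close>.\<close>

lemma coercive_cinvertible:
  fixes A :: "'a::complex_hilbert \<Rightarrow> 'a"
  assumes A: "bounded_clinear A" and c: "0 < c" and coercive: "\<And>x. c * (norm x)\<^sup>2 \<le> inner (A x) x"
  shows "cinvertible A"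
proof -
  interpret A: bounded_linear A using A by (rule bounded_clinear_linear)
  obtain K where K: "K > 0" "\<And>x. norm (A x) \<le> norm x * K"
    using A.pos_bounded by blast
  have lower: "c * norm x \<le> norm (A x)" for x
  proof (cases "x = 0")
    case False
    have "norm x * (c * norm x) \<le> norm x * norm (A x)"
      using coercive[of x] norm_cauchy_schwarz[of "A x" x] by (simp add: power2_eq_square mult_ac)
    then show ?thesis using False by simp
  qed simp
  \<comment> \<open>Adding \<open>c\<close> keeps a norm bound for \<open>A\<close> and makes
    \<open>c / M\<close> strictly less than 1.\<close>
  define M where "M = K + c"
  have M: "M > 0" "c < M" "\<And>x. norm (A x) \<le> norm x * M"
    using K c by (auto simp: M_def algebra_simps add_increasing2)
  \<comment> \<open>This \<open>r\<close> minimises \<open>1 - 2 * r * c + r^2 * M^2\<close>, the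
    bound for the squared contraction factor; the minimum is \<open>q^2\<close>.\<close>
  define r where "r = c / M\<^sup>2"
  define q where "q = sqrt (1 - (c / M)\<^sup>2)"
  have cM: "0 < c / M" "c / M < 1" using c M by simp_all
  then have "(c / M)\<^sup>2 < 1" by (simp add: abs_square_less_1)
  then have q: "0 \<le> q" "q < 1" "q\<^sup>2 = 1 - (c / M)\<^sup>2"
    using cM by (auto simp: q_def)
  have contr: "norm (x - r *\<^sub>R A x) \<le> q * norm x" for x
  proof (rule power2_le_imp_le)
    have r: "0 \<le> r" using c by (simp add: r_def)
    have "(norm (x - r *\<^sub>R A x))\<^sup>2 = (norm x)\<^sup>2 - 2 * r * inner (A x) x + r\<^sup>2 * (norm (A x))\<^sup>2"
      unfolding power2_norm_eq_inner
      by (simp add: inner_diff_left inner_diff_right inner_commute[of x "A x"]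
          power2_eq_square algebra_simps)
    also have "\<dots> \<le> (norm x)\<^sup>2 - 2 * r * (c * (norm x)\<^sup>2) + r\<^sup>2 * (norm x * M)\<^sup>2"
      by (intro add_mono diff_left_mono mult_left_mono coercive power_mono M(3)) (simp_all add: r)
    also have "\<dots> = (q * norm x)\<^sup>2"
      unfolding power_mult_distrib q(3) r_def using M(1)
      by (simp add: field_simps power2_eq_square)
    finally show "(norm (x - r *\<^sub>R A x))\<^sup>2 \<le> (q * norm x)\<^sup>2" .
  qed (simp add: q(1))
  have "\<exists>x. A x = y" for y
  proof -
    have "\<exists>!x. x - r *\<^sub>R (A x - y) = x"
    proof (rule banach_fix_type[OF q(1,2)], intro allI)
      show "dist (x - r *\<^sub>R (A x - y)) (z - r *\<^sub>R (A z - y)) \<le> q * dist x z" for x z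
        using contr[of "x - z"] by (simp add: dist_norm A.diff algebra_simps)
    qed
    then show ?thesis using c M(1) by (auto simp: r_def)
  qed
  then obtain B where AB: "\<And>y. A (B y) = y" by metis
  have inj: "x = z" if "A x = A z" for x z
    using lower[of "x - z"] that c by (simp add: A.diff mult_le_0_iff)
  have BA: "B (A x) = x" for x by (rule inj) (rule AB)
  have "bounded_linear B"
  proof (rule bounded_linear_intro[of _ "inverse c"])
    show "B (x + y) = B x + B y" for x y by (rule inj) (simp add: A.add AB)
    show "B (s *\<^sub>R x) = s *\<^sub>R B x" for s x by (rule inj) (simp add: A.scaleR AB)
    show "norm (B x) \<le> norm x * inverse c" for x
      using lower[of "B x"] c by (simp add: AB field_simps)
  qed
  moreover have "B (z *\<^sub>C x) = z *\<^sub>C B x" for z x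
    by (rule inj) (simp add: bounded_clinear_scaleC[OF A] AB)
  ultimately show ?thesis
    unfolding cinvertible_def bounded_clinear_def using AB BA by blast
qed

text \<open>The difference \<open>cadjoint A A - r^2\<close> factors as
  \<open>(M - r) (M + r)\<close> with \<open>M\<close> the modulus. The second factor is coercive
  with constant \<open>r\<close>, hence invertible, and can be cancelled.\<close>

lemma spectrum_modulus_op_iff:
  fixes A :: "'a::complex_hilbert \<Rightarrow> 'a"
  assumes A: "bounded_clinear A" and r: "0 < r"
  shows "complex_of_real r \<in> spectrum_op (modulus_op A) \<longleftrightarrow>
    \<not> cinvertible (\<lambda>x. cadjoint A (A x) - of_real (r\<^sup>2) *\<^sub>C x)"
proof -
  let ?M = "modulus_op A"
  have M: "bounded_clinear ?M"
    using positive_op_modulus[OF A] by (simp add: positive_op_def)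
  have lin: "bounded_clinear (\<lambda>x. ?M x + of_real r *\<^sub>C x)"
    by (intro bounded_clinear_intros M)
  have inv: "cinvertible (\<lambda>x. ?M x + of_real r *\<^sub>C x)"
  proof (rule coercive_cinvertible[OF lin r])
    show "r * (norm x)\<^sup>2 \<le> inner (?M x + of_real r *\<^sub>C x) x" for x
      using positive_op_inner_nonneg[OF positive_op_modulus[OF A], of x]
      by (simp add: inner_add_left power2_norm_eq_inner flip: scaleR_scaleC)
  qed
  have "cadjoint A (A x) - of_real (r\<^sup>2) *\<^sub>C x
      = ?M (?M x + of_real r *\<^sub>C x) - of_real r *\<^sub>C (?M x + of_real r *\<^sub>C x)" for x
    by (simp add: bounded_clinear_simps[OF M] modulus_op_square[OF A] scaleC_add_right
        scaleC_scaleC power2_eq_square)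
  then show ?thesis
    using cinvertible_compose_iff[OF lin inv, of "\<lambda>x. ?M x - of_real r *\<^sub>C x"]
    by (simp add: spectrum_op_iff)
qed

text \<open>Block Gaussian elimination with the invertible corner \<open>a\<close>. The inverse of
  the Schur complement is the lower right entry of the block inverse; conversely, back substitution
  builds the block inverse.\<close>

lemma cinvertible_schur_complement:
  fixes a :: "'a::complex_inner \<Rightarrow> 'a" and d :: "'b::complex_inner \<Rightarrow> 'b"
  assumes lin: "bounded_clinear a" "bounded_clinear a'" "bounded_clinear b" "bounded_clinear c"
      "bounded_clinear d"
    and a': "\<And>x. a' (a x) = x" "\<And>x. a (a' x) = x"
  shows "cinvertible (\<lambda>p. (a (fst p) + b (snd p), c (fst p) + d (snd p))) \<longleftrightarrow>
    cinvertible (\<lambda>y. d y - c (a' (b y)))" (is "cinvertible ?H \<longleftrightarrow> cinvertible ?s")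
proof
  assume "cinvertible ?H"
  then obtain G where G: "bounded_clinear G" "\<And>p. G (?H p) = p" "\<And>p. ?H (G p) = p"
    unfolding cinvertible_def by metis
  have "?s (snd (G (0, y))) = y" for y
  proof -
    obtain u v where uv: "G (0, y) = (u, v)" by fastforce
    have eq: "a u + b v = 0" "c u + d v = y" using G(3)[of "(0, y)"] by (simp_all add: uv)
    have "a' (a u + b v) = 0" by (simp add: eq bounded_clinear_zero[OF lin(2)])
    then have "u = - a' (b v)" by (simp add: bounded_clinear_add[OF lin(2)] a' add_eq_0_iff2)
    with eq(2) show ?thesis by (simp add: uv bounded_clinear_neg[OF lin(4)])
  qed
  \<comment> \<open>The vector \<open>(- a' (b y), y)\<close> is chosen so that its image has first
    component 0 and second component \<open>?s y\<close>.\<close>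
  moreover have "snd (G (0, ?s y)) = y" for y
    using G(2)[of "(- a' (b y), y)"]
    by (simp add: bounded_clinear_neg[OF lin(1)] bounded_clinear_neg[OF lin(4)] a')
  moreover have "bounded_clinear (\<lambda>y. snd (G (0, y)))"
    by (intro bounded_clinear_snd bounded_clinear_compose[OF G(1)] bounded_clinear_Pair
        bounded_clinear_intros)
  ultimately show "cinvertible ?s" unfolding cinvertible_def by blast
next
  assume "cinvertible ?s"
  then obtain s' where s': "bounded_clinear s'" "\<And>y. s' (?s y) = y" "\<And>y. ?s (s' y) = y"
    unfolding cinvertible_def by metis
  \<comment> \<open>Solving the first row for the first unknown and inserting it into the second row
    leaves \<open>?s\<close> applied to the second unknown, which is \<open>Y p\<close>.\<close>
  define Y where "Y p = s' (snd p - c (a' (fst p)))" for p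
  define G where "G p = (a' (fst p - b (Y p)), Y p)" for p
  have Y: "bounded_clinear Y"
    unfolding Y_def
    by (intro bounded_clinear_compose[OF s'(1)] bounded_clinear_intros bounded_clinear_snd
        bounded_clinear_fst bounded_clinear_compose[OF lin(4)] bounded_clinear_compose[OF lin(2)])
  have "bounded_clinear G"
    unfolding G_def
    by (intro bounded_clinear_Pair bounded_clinear_compose[OF lin(2)]
        bounded_clinear_compose[OF lin(3)] bounded_clinear_intros bounded_clinear_fst Y)
  moreover have "G (?H p) = p" for p
  proof -
    have "Y (?H p) = s' (?s (snd p))"
      by (simp add: Y_def bounded_clinear_add[OF lin(2)] bounded_clinear_add[OF lin(4)] a')
    also have "\<dots> = snd p" by (rule s')
    finally show ?thesis by (simp add: G_def a')
  qed
  moreover have "?H (G p) = p" for p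
  proof -
    have "?s (Y p) = snd p - c (a' (fst p))" unfolding Y_def by (rule s')
    then show ?thesis
      by (simp add: G_def a' prod_eq_iff bounded_clinear_diff[OF lin(1)]
          bounded_clinear_diff[OF lin(2)] bounded_clinear_diff[OF lin(4)] algebra_simps)
  qed
  ultimately show "cinvertible ?H" unfolding cinvertible_def by blast
qed

subsection \<open>The shift and Foguel operators\<close>

lemma cinner_shift: "cinner (shift x) (shift y) = cinner x (y :: 'a::complex_inner l2seq)"
proof -
  have "cinner 0 (0 :: 'a) = 0" by (simp add: cinner_self)
  then show ?thesis
    using suminf_split_head[OF l2_summable_cinner[of "shift x" "shift y"]]
    by (simp add: cinner_l2seq_def shift.rep_eq)
qed

lemma bounded_clinear_shift: "bounded_clinear (shift :: 'a::complex_inner l2seq \<Rightarrow> _)"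
proof -
  have add: "shift (x + y) = shift x + shift y" for x y :: "'a l2seq"
    by (rule l2_eqI) (simp add: shift.rep_eq plus_l2seq.rep_eq split: nat.split)
  have scale: "shift (c *\<^sub>C x) = c *\<^sub>C shift x" for c and x :: "'a l2seq"
    by (rule l2_eqI) (simp add: shift.rep_eq scaleC_l2seq.rep_eq split: nat.split)
  have "norm (shift x) = norm x" for x :: "'a l2seq"
    by (simp add: norm_eq_sqrt_inner inner_eq_Re_cinner cinner_shift)
  then have "bounded_linear (shift :: 'a l2seq \<Rightarrow> _)"
    by (intro bounded_linear_intro[of _ 1]) (simp_all add: add scale scaleR_scaleC)
  then show ?thesis by (simp add: bounded_clinear_def scale)
qed

lemma cadjoint_shift_shift: "cadjoint shift (shift x) = (x :: 'a::complex_hilbert l2seq)"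
  by (rule cinner_ext_right)
    (simp add: cinner_shift flip: cinner_cadjoint[OF bounded_clinear_shift])

lemma cinner_funpow_shift:
  fixes x y :: "'a::complex_hilbert l2seq"
  shows "cinner ((shift ^^ n) x) y = cinner x ((cadjoint shift ^^ n) y)"
  by (induction n arbitrary: x y)
    (simp_all add: cinner_cadjoint[OF bounded_clinear_shift] funpow_swap1)

lemma cadjoint_shift_funpow_shift:
  "(cadjoint shift ^^ n) ((shift ^^ n) x) = (x :: 'a::complex_hilbert l2seq)"
proof (induction n)
  case (Suc n)
  then show ?case by (simp add: funpow_swap1[of "cadjoint shift"] cadjoint_shift_shift)
qed simp

lemma bounded_clinear_cadjoint_shift_funpow:
  "bounded_clinear ((cadjoint shift ^^ n) :: 'a::complex_hilbert l2seq \<Rightarrow> _)"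
  by (intro bounded_clinear_funpow bounded_clinear_cadjoint bounded_clinear_shift)

lemma bounded_clinear_shift_funpow:
  "bounded_clinear ((shift ^^ n) :: 'a::complex_inner l2seq \<Rightarrow> _)"
  by (intro bounded_clinear_funpow bounded_clinear_shift)

lemma bounded_clinear_foguel:
  fixes T :: "'a::complex_hilbert l2seq \<Rightarrow> 'a l2seq"
  assumes "bounded_clinear T"
  shows "bounded_clinear (foguel T n)"
  unfolding foguel_def case_prod_unfold
  by (intro bounded_clinear_Pair bounded_clinear_intros bounded_clinear_fst bounded_clinear_snd
      bounded_clinear_compose[OF assms] bounded_clinear_compose[OF bounded_clinear_shift_funpow]
      bounded_clinear_compose[OF bounded_clinear_cadjoint_shift_funpow])

lemma cadjoint_foguel:
  fixes T :: "'a::complex_hilbert l2seq \<Rightarrow> 'a l2seq"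
  assumes "bounded_clinear T"
  shows "cadjoint (foguel T n) =
    (\<lambda>(x, y). ((shift ^^ n) x, cadjoint T x + (cadjoint shift ^^ n) y))"
proof (rule cadjoint_eqI)
  have W: "cinner ((cadjoint shift ^^ n) u) v = cinner u ((shift ^^ n) v)"
    for u v :: "'a l2seq"
    by (metis cinner_commute cinner_funpow_shift)
  show "cinner (foguel T n p) q = cinner p
      ((\<lambda>(x, y). ((shift ^^ n) x, cadjoint T x + (cadjoint shift ^^ n) y)) q)" for p q
    by (simp add: foguel_def cinner_prod_def case_prod_unfold cinner_add_left cinner_add_right
        W cinner_funpow_shift cinner_cadjoint[OF assms])
qed

text \<open>The corner of \<open>R\<^sup>* R - m\<close> with \<open>R\<close> the Foguel operator is \<open>P - m\<close> for the projection
  \<open>P = S\<^sup>n (S\<^sup>*)\<^sup>n\<close>, with inverse \<open>P / (1 - m) - (1 - P) / m\<close>; its Schur complement is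
  \<open>- m / (1 - m)\<close> times \<open>T\<^sup>* T - (1 - m)\<^sup>2 / m\<close>.\<close>

lemma cinvertible_foguel_iff:
  fixes T :: "'a::complex_hilbert l2seq \<Rightarrow> 'a l2seq" and m :: complex
  assumes T: "bounded_clinear T" and m: "m \<noteq> 0" "m \<noteq> 1"
  shows "cinvertible (\<lambda>p. cadjoint (foguel T n) (foguel T n p) - m *\<^sub>C p) \<longleftrightarrow>
    cinvertible (\<lambda>y. cadjoint T (T y) - ((1 - m)\<^sup>2 / m) *\<^sub>C y)"
proof -
  define V :: "'a l2seq \<Rightarrow> 'a l2seq" where "V = shift ^^ n"
  define W :: "'a l2seq \<Rightarrow> 'a l2seq" where "W = cadjoint shift ^^ n"
  have V: "bounded_clinear V" unfolding V_def by (rule bounded_clinear_shift_funpow)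
  have W: "bounded_clinear W" unfolding W_def by (rule bounded_clinear_cadjoint_shift_funpow)
  have WV: "W (V x) = x" for x by (simp add: W_def V_def cadjoint_shift_funpow_shift)
  have T': "bounded_clinear (cadjoint T)" by (rule bounded_clinear_cadjoint[OF T])
  note lins = bounded_clinear_intros bounded_clinear_compose[OF V] bounded_clinear_compose[OF W]
    bounded_clinear_compose[OF T] bounded_clinear_compose[OF T'] V W T T'
  note lin_simps = bounded_clinear_simps[OF V] bounded_clinear_simps[OF W]
    bounded_clinear_simps[OF T]  bounded_clinear_simps[OF T']
  \<comment> \<open>With this \<open>\<alpha>\<close>, \<open>a'\<close> acts as
    \<open>inverse (1 - m)\<close> on the range of the projection \<open>V W\<close> and as
    \<open>- inverse m\<close> on its kernel, inverting \<open>a\<close> on each.\<close>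
  define \<alpha> where "\<alpha> = inverse (1 - m) + inverse m"
  define a where "a x = V (W x) - m *\<^sub>C x" for x
  define a' where "a' x = \<alpha> *\<^sub>C V (W x) - inverse m *\<^sub>C x" for x
  have \<alpha>: "\<alpha> - \<alpha> * m - inverse m = 0"
    using m by (simp add: \<alpha>_def field_simps)
  \<comment> \<open>As \<open>W V = 1\<close>, each composite of \<open>a\<close> and
    \<open>a'\<close> is the identity plus \<open>\<alpha> - \<alpha> * m - inverse m\<close> times
    \<open>V W\<close>. This relation removes the extra term.\<close>
  have P: "\<alpha> *\<^sub>C z = (\<alpha> * m) *\<^sub>C z + inverse m *\<^sub>C z" for z :: "'a l2seq"
    using \<alpha> by (simp add: algebra_simps flip: scaleC_add_left)
  have a'a: "a' (a x) = x" for x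
    using P[of "V (W x)"] m
    by (simp add: a_def a'_def lin_simps WV scaleC_diff_right scaleC_scaleC algebra_simps)
  have aa': "a (a' x) = x" for x
  proof -
    have "a (a' x) = \<alpha> *\<^sub>C V (W x) - ((\<alpha> * m) *\<^sub>C V (W x) + inverse m *\<^sub>C V (W x)) + x"
      using m by (simp add: a_def a'_def lin_simps WV scaleC_diff_right scaleC_scaleC mult.commute)
    then show ?thesis by (simp flip: P)
  qed
  \<comment> \<open>The term \<open>1 - m\<close> in the lower right entry arises from
    \<open>W V = 1\<close>.\<close>
  have R: "(\<lambda>p. cadjoint (foguel T n) (foguel T n p) - m *\<^sub>C p) =
      (\<lambda>p. (a (fst p) + V (T (snd p)),
        cadjoint T (W (fst p)) + (cadjoint T (T (snd p)) + (1 - m) *\<^sub>C snd p)))"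
    unfolding cadjoint_foguel[OF T] unfolding foguel_def
    by (simp add: fun_eq_iff scaleC_prod_def
        scaleC_diff_left lin_simps WV a_def algebra_simps flip: V_def W_def)
  have schur: "cadjoint T (T y) + (1 - m) *\<^sub>C y - cadjoint T (W (a' (V (T y))))
      = (- m / (1 - m)) *\<^sub>C (cadjoint T (T y) - ((1 - m)\<^sup>2 / m) *\<^sub>C y)" for y
  proof -
    \<comment> \<open>Compressed between \<open>W\<close> and \<open>V\<close>, the operator
      \<open>a'\<close> becomes the scalar
      \<open>\<alpha> - inverse m = inverse (1 - m)\<close>.\<close>
    have "cadjoint T (W (a' (V (T y)))) = (\<alpha> - inverse m) *\<^sub>C cadjoint T (T y)"
      by (simp add: a'_def lin_simps WV scaleC_diff_left)
    moreover have "1 - (\<alpha> - inverse m) = - m / (1 - m)"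
      using m by (simp add: \<alpha>_def field_simps)
    then have "cadjoint T (T y) - (\<alpha> - inverse m) *\<^sub>C cadjoint T (T y)
        = (- m / (1 - m)) *\<^sub>C cadjoint T (T y)"
      by (metis scaleC_diff_left scaleC_one)
    \<comment> \<open>Extracting the coefficient of \<open>cadjoint T (T y)\<close> from the
      remaining scalar \<open>1 - m\<close> produces the shift \<open>(1 - m)^2 / m\<close>.\<close>
    moreover have "1 - m = - ((- m / (1 - m)) * ((1 - m)\<^sup>2 / m))"
      using m by (simp add: field_simps power2_eq_square)
    then have "(1 - m) *\<^sub>C y = - (((- m / (1 - m)) * ((1 - m)\<^sup>2 / m)) *\<^sub>C y)"
      by (metis diff_0 scaleC_diff_left scaleC_zero_left)
    ultimately show ?thesis
      unfolding scaleC_diff_right scaleC_scaleC by simp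
  qed
  have lin: "bounded_clinear a" "bounded_clinear a'" "bounded_clinear (\<lambda>y. V (T y))"
    "bounded_clinear (\<lambda>x. cadjoint T (W x))"
    "bounded_clinear (\<lambda>y. cadjoint T (T y) + (1 - m) *\<^sub>C y)"
    "bounded_clinear (\<lambda>y. cadjoint T (T y) - ((1 - m)\<^sup>2 / m) *\<^sub>C y)"
    unfolding a_def a'_def by (intro lins)+
  have "- m / (1 - m) \<noteq> 0" using m by simp
  then show ?thesis
    unfolding R cinvertible_schur_complement[OF lin(1-5) a'a aa'] schur
    by (rule cinvertible_scaleC_iff[OF _ lin(6)])
qed

theorem theorem1:
  fixes T :: "'e::complex_hilbert l2seq \<Rightarrow> 'e l2seq" and n :: nat and \<mu> :: real
  assumes "separable_space (euclidean :: 'e topology)"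
    and "bounded_clinear T"
    and "0 < \<mu>"
  shows "complex_of_real \<mu> \<in> spectrum_op (modulus_op (foguel T n)) - {0, 1} \<longleftrightarrow>
    complex_of_real \<bar>\<mu> - inverse \<mu>\<bar> \<in> spectrum_op (modulus_op T) - {0}"
proof (cases "\<mu> = 1")
  case False
  let ?\<nu> = "\<bar>\<mu> - inverse \<mu>\<bar>"
  \<comment> \<open>Positivity of \<open>\<mu>\<close> excludes -1. This secures both
    \<open>m \<noteq> 1\<close> for the Foguel equivalence and a positive \<open>?\<nu>\<close> for
    the modulus equivalence.\<close>
  have sq: "\<mu>\<^sup>2 \<noteq> 1" using assms(3) False by (simp add: power2_eq_1_iff)
  then have pos: "0 < ?\<nu>"
    using assms(3) by (simp add: power2_eq_square nonzero_eq_divide_eq inverse_eq_divide)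
  have "(1 - \<mu>\<^sup>2)\<^sup>2 / \<mu>\<^sup>2 = ?\<nu>\<^sup>2"
    using assms(3) by (simp add: field_simps power2_eq_square)
  from arg_cong[OF this, of complex_of_real]
  have \<nu>: "(1 - complex_of_real (\<mu>\<^sup>2))\<^sup>2 / complex_of_real (\<mu>\<^sup>2) = complex_of_real (?\<nu>\<^sup>2)"
    by (simp only: of_real_1 of_real_diff of_real_divide of_real_power)
  have "complex_of_real (\<mu>\<^sup>2) \<noteq> 0" "complex_of_real (\<mu>\<^sup>2) \<noteq> 1"
    unfolding of_real_eq_0_iff of_real_eq_1_iff using assms(3) sq by simp_all
  from cinvertible_foguel_iff[OF assms(2) this, of n]
  have "complex_of_real \<mu> \<in> spectrum_op (modulus_op (foguel T n)) \<longleftrightarrow>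
      complex_of_real ?\<nu> \<in> spectrum_op (modulus_op T)"
    unfolding \<nu> spectrum_modulus_op_iff[OF bounded_clinear_foguel[OF assms(2)] assms(3)]
      spectrum_modulus_op_iff[OF assms(2) pos] by simp
  moreover have "complex_of_real \<mu> \<notin> {0, 1}" "complex_of_real ?\<nu> \<notin> {0}"
    using assms(3) False pos by simp_all
  ultimately show ?thesis by blast
\<comment> \<open>For \<open>\<mu> = 1\<close> both sides fail: the left excludes 1, and on the
  right the value is 0, which is excluded too.\<close>
qed simp

end
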